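(* Let $(\Gamma, T)$ with $T=\{t_0,t_1,t_2\}$ be a string C-group which characterizes the automorphism group of a regular abstract polyhedron $\mathcal{P}$. Identify $\mathcal{P}$ with the coset poset of $(\Gamma,T)$, with faces $F_{i,j}=\Gamma_i\gamma_{i,j}$ and $\Gamma$ acting by right multiplication. Let $\varphi:\Gamma\to O(3)$ be a faithful irreducible orthogonal representation of $\Gamma$, and put $G=\varphi(\Gamma)$ and $G_i=\varphi(\Gamma_i)$. Then the following sequence of steps produces a faithful symmetric realization $\rho$ of $\mathcal{P}$. 1. For $0\le i\le 3$, generate a complete list of right coset representatives $\gamma_{i,j}$, $1\le j\le[\Gamma:\Gamma_i]$, of $\Gamma_i$ in $\Gamma$, with $\gamma_{i,1}=e$. 2. Compute the matrix representations $\varphi(\gamma_{i,j})$ of the coset representatives $\gamma_{i,j}$. 3. Compute the Wythoff space $\mathcal{W}(\varphi,(\Gamma,T))=\{\mathbf{x}\in\mathbb{E}^3 \mid \mathbf{x}\,\varphi(t_1)=\mathbf{x}\,\varphi(t_2)=\mathbf{x}\}$ associated with the pair $(\varphi,(\Gamma,T))$, consisting of the points of $\mathbb{E}^3$ fixed by both $\varphi(t_1)$ and $\varphi(t_2)$. 4. Pick a point $\mathbf{x}\in\mathcal{W}(\varphi,(\Gamma,T))$ and let $\mathcal{O}_{0,1}$ be $\mathbf{x}$ (that is, the one-point set $\{\mathbf{x}\}$). 5. For $i=1,2,3$ successively: (a) determine the abstract $(i-1)$-faces incident to the base abstract $i$-face $F_{i,1}$; equivalently, determine the indexing set $J_i=\{j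 \mid \Gamma_{i-1}\gamma_{i-1,j}\cap\Gamma_i\ne\varnothing\}$; (b) compute the open sets $\mathcal{O}_{i-1,j}=\mathcal{O}_{i-1,1}\,\varphi(\gamma_{i-1,j})$ for each $j\in J_i$; (c) let $\mathcal{O}_{i,1}\subseteq\mathbb{E}^3$ be a non-empty open set of dimension $i$ that is bounded by the sets $\mathcal{O}_{i-1,j}$, $j\in J_i$, and stabilized in $G$ by $G_i$, meaning that its (setwise) stabilizer in $G$ is $G_i$. Here "bounded by" is meant in the sense required of a realization: the boundary of $\mathcal{O}_{i,1}$ is the union of the sets $\mathcal{O}_{k,l}=\mathcal{O}_{k,1}\,\varphi(\gamma_{k,l})$ over all $0\le k<i$ and all $l$ with $F_{k,l}\le F_{i,1}$. 6. For $0\le i\le3$, define $\rho_i$ to be the map on the set $\mathcal{P}_i$ of $i$-faces that sends each $F_{i,j}$ to $\mathcal{O}_{i,j}=\mathcal{O}_{i,1}\,\varphi(\gamma_{i,j})$ for $1\le j\le[\Gamma:\Gamma_i]$. 7. Define $\rho$ to be the map on $\mathcal{P}$ whose restriction to $\mathcal{P}_i$ is $\rho_i$ (the empty face $F_{-1}$ being sent to $\varnothing$, as for every realization).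
   Context: **Abstract polyhedra.** Let $\mathcal{P}$ be a non-empty finite partially ordered set, whose elements are called faces. Two faces $F,G$ are incident if $F\le G$ or $G\le F$. A flag is a maximal totally ordered subset. Two flags are adjacent if they differ in exactly one face. A poset is flag-connected if any two flags are joined by a finite sequence of flags in which consecutive flags are adjacent. For $F\le G$ the section $G/F$ is $\{H : F\le H\le G\}$. $\mathcal{P}$ is an abstract polyhedron if: (P1) it has a unique least face and a unique greatest face; (P2) every flag contains exactly 5 faces (including the least and greatest faces); (P3) every section is flag-connected; (P4) with the rank of a face being the number of faces, excluding the least face, that precede it in any flag (and $-1$ for the least face), whenever $F_{i-1}\le F_{i+1}$ are faces of ranks $i-1$ and $i+1$ with $0\le i\le 2$, there are exactly two faces $F_i$ of rank $i$ with $F_{i-1}\le F_i\le F_{i+1}$. A face of rank $i$ is an (abstract) $i$-face, and $\mathcal{P}_i$ is the set of $i$-faces, $-1\le i\le 3$. The least face $F_{-1}$ is called the empty face. An automorphism is a bijection $\gamma$ of $\mathcal{P}$ with $F\le G\iff\gamma(F)\le\gamma(G)$. The automorphism group $\Gamma$ acts on the right, $F\mapsto F\gamma$, with products read left to right. $\mathcal{P}$ is regular if $\Gamma$ acts transitively on its flags. **String C-groups.** A (rank 3) string C-group of type $\{p,q\}$ is a pair $(\Gamma,T)$ where $\Gamma$ is a group and $T=\{t_0,t_1,t_2\}$ is an ordered triple of distinct involutions generating $\Gamma$ such that $t_0t_2=t_2t_0$, $\langle t_0,t_1\rangle\cap\langle t_1,t_2\rangle=\langle t_1\rangle$, $t_0t_1$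 has order $p$ and $t_1t_2$ has order $q$. All groups here are finite. Put $\Gamma_{-1}=\Gamma_3=\Gamma$ and $\Gamma_i=\langle t_k\mid k\ne i\rangle$ for $0\le i\le2$. **Coset poset.** Regular abstract polyhedra correspond bijectively to rank 3 string C-groups. The polyhedron with group $(\Gamma,T)$ has as $i$-faces the right cosets $F_{i,j}=\Gamma_i\gamma_{i,j}$, where $\gamma_{i,j}$ ($1\le j\le[\Gamma:\Gamma_i]$) are right coset representatives of $\Gamma_i$ and $\gamma_{i,1}=e$; faces of different ranks are regarded as distinct. The order is $F_{i,j}\le F_{i',j'}$ iff $i\le i'$ and $\Gamma_i\gamma_{i,j}\cap\Gamma_{i'}\gamma_{i',j'}\ne\varnothing$. The action of $\gamma\in\Gamma$ is $(\Gamma_i\gamma_{i,j})\gamma=\Gamma_i\gamma_{i,j}\gamma$. The base $i$-face is $F_{i,1}=\Gamma_i$. **Conventions on isometries.** Elements of $O(3)$ act on $\mathbb{E}^3$ on the right: $\mathbf{x}\,\varphi(\gamma)$ denotes the image of $\mathbf{x}$ and $\mathcal{O}\,\varphi(\gamma)$ the image of a set $\mathcal{O}$, so that $\mathbf{x}\,\varphi(\gamma\delta)=(\mathbf{x}\,\varphi(\gamma))\,\varphi(\delta)$. An orthogonal representation is faithful if it is injective. **Realizations.** An open set of dimension $i$ in $\mathbb{E}^3$ is a subset homeomorphic to an open set of $\mathbb{E}^i$. The boundary of such a set is its closure minus the set itself. A (full rank geometric) realization $\rho$ of $\mathcal{P}$ assigns $\varnothing$ to the empty face and to each $i$-face $F_{i,j}$,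 $0\le i\le3$, a non-empty open set $\rho_i(F_{i,j})=\mathcal{O}_{i,j}\subseteq\mathbb{E}^3$ of dimension $i$, such that the boundary of $\mathcal{O}_{i,j}$ is $\bigcup_{0\le k<i}\bigcup_{F_{k,l}\le F_{i,j}}\mathcal{O}_{k,l}$. Here $\rho_i$ denotes the restriction of $\rho$ to $\mathcal{P}_i$. The realization is faithful if each $\rho_i$ is injective. It is symmetric if there is an orthogonal representation $\varphi:\Gamma\to O(3)$ with $\rho_i(F_{i,j}\gamma)=\rho_i(F_{i,j})\,\varphi(\gamma)$ for all $\gamma\in\Gamma$ and all faces $F_{i,j}$.
   Formalization: Faithfulness of the realization is claimed only when the point x picked in the Wythoff space is nonzero, since for x = 0 all vertices are sent to the origin and faithfulness fails; symmetry is claimed for every x. *)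

theory Defs
  imports "HOL-Analysis.Analysis"
    "HOL-Algebra.Coset" "HOL-Algebra.Generated_Groups" "HOL-Algebra.Multiplicative_Group"
begin

section \<open>String C-groups of rank 3\<close>

text \<open>
  The ordered triple of generators is given by the values of \<open>t\<close> at \<open>0, 1, 2\<close>.
  Ranks are integers, since they range over \<open>-1, \<dots>, 3\<close>.
\<close>

definition string_C_group ::
    "('g, 'm) monoid_scheme \<Rightarrow> (int \<Rightarrow> 'g) \<Rightarrow> nat \<Rightarrow> nat \<Rightarrow> bool" where
  "string_C_group \<Gamma> t p q \<longleftrightarrow>
     group \<Gamma> \<and> finite (carrier \<Gamma>) \<and>
     t ` {0..2} \<subseteq> carrier \<Gamma> \<and> inj_on t {0..2} \<and>
     (\<forall>k\<in>{0..2}. t k \<noteq> \<one>\<^bsub>\<Gamma>\<^esub> \<and> t k \<otimes>\<^bsub>\<Gamma>\<^esub> t k = \<one>\<^bsub>\<Gamma>\<^esub>) \<and>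
     generate \<Gamma> (t ` {0..2}) = carrier \<Gamma> \<and>
     t 0 \<otimes>\<^bsub>\<Gamma>\<^esub> t 2 = t 2 \<otimes>\<^bsub>\<Gamma>\<^esub> t 0 \<and>
     generate \<Gamma> {t 0, t 1} \<inter> generate \<Gamma> {t 1, t 2} = generate \<Gamma> {t 1} \<and>
     group.ord \<Gamma> (t 0 \<otimes>\<^bsub>\<Gamma>\<^esub> t 1) = p \<and>
     group.ord \<Gamma> (t 1 \<otimes>\<^bsub>\<Gamma>\<^esub> t 2) = q"

definition face_group :: "('g, 'm) monoid_scheme \<Rightarrow> (int \<Rightarrow> 'g) \<Rightarrow> int \<Rightarrow> 'g set" where
  "face_group \<Gamma> t i =
     (if i \<in> {0..2} then generate \<Gamma> (t ` ({0..2} - {i})) else carrier \<Gamma>)"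


section \<open>The coset poset\<close>

text \<open>
  A face is a coset tagged with its rank, so that faces of different ranks are distinct
  even if they are equal as cosets.
\<close>

type_synonym 'g face = "int \<times> 'g set"

definition faces :: "('g, 'm) monoid_scheme \<Rightarrow> (int \<Rightarrow> 'g) \<Rightarrow> 'g face set" where
  "faces \<Gamma> t = (SIGMA i:{-1..3}. rcosets\<^bsub>\<Gamma>\<^esub> (face_group \<Gamma> t i))"

definition faces_of_rank ::
    "('g, 'm) monoid_scheme \<Rightarrow> (int \<Rightarrow> 'g) \<Rightarrow> int \<Rightarrow> 'g face set" where
  "faces_of_rank \<Gamma> t i = {F \<in> faces \<Gamma> t. fst F = i}"

definition face_le :: "'g face \<Rightarrow> 'g face \<Rightarrow> bool" where
  "face_le F F' \<longleftrightarrow> fst F \<le> fst F' \<and> snd F \<inter> snd F' \<noteq> {}"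

definition face_act :: "('g, 'm) monoid_scheme \<Rightarrow> 'g face \<Rightarrow> 'g \<Rightarrow> 'g face" where
  "face_act \<Gamma> F g = (fst F, snd F #>\<^bsub>\<Gamma>\<^esub> g)"

definition index :: "('g, 'm) monoid_scheme \<Rightarrow> (int \<Rightarrow> 'g) \<Rightarrow> int \<Rightarrow> nat" where
  "index \<Gamma> t i = card (rcosets\<^bsub>\<Gamma>\<^esub> (face_group \<Gamma> t i))"

definition coset_representatives ::
    "('g, 'm) monoid_scheme \<Rightarrow> (int \<Rightarrow> 'g) \<Rightarrow> int \<Rightarrow> (nat \<Rightarrow> 'g) \<Rightarrow> bool" where
  "coset_representatives \<Gamma> t i c \<longleftrightarrow>
     (\<forall>j\<in>{1..index \<Gamma> t i}. c j \<in> carrier \<Gamma>) \<and>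
     bij_betw (\<lambda>j. face_group \<Gamma> t i #>\<^bsub>\<Gamma>\<^esub> c j) {1..index \<Gamma> t i}
       (rcosets\<^bsub>\<Gamma>\<^esub> (face_group \<Gamma> t i)) \<and>
     c 1 = \<one>\<^bsub>\<Gamma>\<^esub>"

definition face ::
    "('g, 'm) monoid_scheme \<Rightarrow> (int \<Rightarrow> 'g) \<Rightarrow> (int \<Rightarrow> nat \<Rightarrow> 'g) \<Rightarrow> int \<Rightarrow> nat \<Rightarrow> 'g face" where
  "face \<Gamma> t \<gamma> i j = (i, face_group \<Gamma> t i #>\<^bsub>\<Gamma>\<^esub> \<gamma> i j)"


section \<open>Orthogonal representations\<close>

text \<open>
  Isometries act on the right: points are row vectors and a matrix \<open>A\<close> sends \<open>x\<close> to \<open>x v* A\<close>,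
  so the product \<open>A ** B\<close> means first \<open>A\<close>, then \<open>B\<close>.
\<close>

definition O3 :: "(real^3^3) monoid" where
  "O3 = \<lparr>carrier = {A. orthogonal_matrix A}, mult = (**), one = mat 1\<rparr>"

definition image_under :: "(real^3) set \<Rightarrow> real^3^3 \<Rightarrow> (real^3) set" where
  "image_under S A = (\<lambda>x. x v* A) ` S"

definition orthogonal_rep :: "('g, 'm) monoid_scheme \<Rightarrow> ('g \<Rightarrow> real^3^3) \<Rightarrow> bool" where
  "orthogonal_rep \<Gamma> \<phi> \<longleftrightarrow> \<phi> \<in> hom \<Gamma> O3"

definition faithful_rep :: "('g, 'm) monoid_scheme \<Rightarrow> ('g \<Rightarrow> real^3^3) \<Rightarrow> bool" where
  "faithful_rep \<Gamma> \<phi> \<longleftrightarrow> inj_on \<phi> (carrier \<Gamma>)"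

definition irreducible_rep :: "('g, 'm) monoid_scheme \<Rightarrow> ('g \<Rightarrow> real^3^3) \<Rightarrow> bool" where
  "irreducible_rep \<Gamma> \<phi> \<longleftrightarrow>
     (\<forall>V. subspace V \<and> (\<forall>g\<in>carrier \<Gamma>. image_under V (\<phi> g) \<subseteq> V) \<longrightarrow> V = {0} \<or> V = UNIV)"

definition wythoff_space :: "('g \<Rightarrow> real^3^3) \<Rightarrow> (int \<Rightarrow> 'g) \<Rightarrow> (real^3) set" where
  "wythoff_space \<phi> t = {x. x v* \<phi> (t 1) = x \<and> x v* \<phi> (t 2) = x}"

definition set_stabilizer :: "(real^3^3) set \<Rightarrow> (real^3) set \<Rightarrow> (real^3^3) set" where
  "set_stabilizer G S = {A \<in> G. image_under S A = S}"


section \<open>Realizations\<close>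

definition open_set_of_dim :: "nat \<Rightarrow> (real^3) set \<Rightarrow> bool" where
  "open_set_of_dim n S \<longleftrightarrow>
     (\<exists>U. openin (Euclidean_space n) U \<and>
          subtopology euclidean S homeomorphic_space subtopology (Euclidean_space n) U)"

text \<open>For a set of dimension less than 3 this is not the topological frontier.\<close>

definition boundary :: "(real^3) set \<Rightarrow> (real^3) set" where
  "boundary S = closure S - S"

definition realization ::
    "('g, 'm) monoid_scheme \<Rightarrow> (int \<Rightarrow> 'g) \<Rightarrow> ('g face \<Rightarrow> (real^3) set) \<Rightarrow> bool" where
  "realization \<Gamma> t \<rho> \<longleftrightarrow>
     (\<forall>F\<in>faces_of_rank \<Gamma> t (-1). \<rho> F = {}) \<and>
     (\<forall>i\<in>{0..3}. \<forall>F\<in>faces_of_rank \<Gamma> t i.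
        \<rho> F \<noteq> {} \<and> open_set_of_dim (nat i) (\<rho> F) \<and>
        boundary (\<rho> F) = (\<Union>k\<in>{0..<i}. \<Union>H\<in>{H \<in> faces_of_rank \<Gamma> t k. face_le H F}. \<rho> H))"

definition faithful_realization ::
    "('g, 'm) monoid_scheme \<Rightarrow> (int \<Rightarrow> 'g) \<Rightarrow> ('g face \<Rightarrow> (real^3) set) \<Rightarrow> bool" where
  "faithful_realization \<Gamma> t \<rho> \<longleftrightarrow>
     realization \<Gamma> t \<rho> \<and> (\<forall>i\<in>{-1..3}. inj_on \<rho> (faces_of_rank \<Gamma> t i))"

definition symmetric_realization ::
    "('g, 'm) monoid_scheme \<Rightarrow> (int \<Rightarrow> 'g) \<Rightarrow> ('g face \<Rightarrow> (real^3) set) \<Rightarrow> bool" where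
  "symmetric_realization \<Gamma> t \<rho> \<longleftrightarrow>
     realization \<Gamma> t \<rho> \<and>
     (\<exists>\<psi>. orthogonal_rep \<Gamma> \<psi> \<and>
        (\<forall>g\<in>carrier \<Gamma>. \<forall>F\<in>faces \<Gamma> t. \<rho> (face_act \<Gamma> F g) = image_under (\<rho> F) (\<psi> g)))"

end

theory Submission
  imports Defs
begin

text \<open>
  Each base set \<open>\<O> i 1\<close> is invariant under the base subgroup \<open>\<Gamma>\<^sub>i\<close> (\<open>face_group \<Gamma> t i\<close>), so the
  set assigned to a coset \<open>\<Gamma>\<^sub>i g\<close> is the image of \<open>\<O> i 1\<close> under \<open>\<phi> g\<close>, whichever representative
  is chosen. The map \<open>\<rho>\<close> is therefore equivariant. Isometries preserve boundaries and
  dimensions, and right multiplication preserves incidence, so the boundary condition at the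
  base faces carries over to all faces; this gives a symmetric realization.

  Two cosets of \<open>\<Gamma>\<^sub>i\<close> receive the same set exactly when their representatives differ by an
  element stabilizing \<open>\<O> i 1\<close>, so faithfulness amounts to the stabilizer of \<open>\<O> i 1\<close> being
  exactly \<open>\<Gamma>\<^sub>i\<close>. In ranks 1 to 3 the choice of \<open>\<O> i 1\<close> ensures this. For the vertices it is a
  theorem: a nonzero point \<open>x\<close> of the Wythoff space has stabilizer \<open>\<Gamma>\<^sub>0\<close>, generated by \<open>t 1\<close>
  and \<open>t 2\<close> (\<open>stabilizer_wythoff_point\<close>). Its proof combines two facts.

  First, the rotations in the group with axis \<open>x\<close>, counting the identity, number at most five
  (\<open>card_rotations_le_5\<close>). They embed in the unit circle, hence are all the rotations by
  multiples of \<open>2 * pi / n\<close>, where \<open>n\<close> is their number. By irreducibility the orbit of \<open>x\<close> is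
  not contained in the axis. Take a point \<open>y\<close> of the orbit, off the axis, as close to \<open>x\<close> as
  possible. If \<open>n \<ge> 6\<close>, rotating \<open>y\<close> about \<open>x\<close> by \<open>2 * pi / n\<close> moves it by less than its
  distance from \<open>x\<close>, so there are two distinct orbit points that are closer together than \<open>x\<close>
  and \<open>y\<close>. Carrying one of them back to \<open>x\<close> takes the other to an orbit point different from
  \<open>x\<close> and closer to it than \<open>y\<close>, hence also different from \<open>-x\<close>, against the choice of \<open>y\<close>.

  Second, \<open>t 1\<close> and \<open>t 2\<close> do not commute: otherwise \<open>t 2\<close> would be central, and as it fixes
  \<open>x\<close>, it would be trivial by irreducibility. Hence both are reflections, and \<open>t 1 t 2\<close> is a
  rotation about \<open>x\<close> of order at least 3. A stabilizer larger than \<open>\<Gamma>\<^sub>0\<close> would then contain at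
  least six rotations, namely three in \<open>\<Gamma>\<^sub>0\<close> and three in another coset
  (\<open>stabilizer_eq_generate_involutions\<close>).
\<close>

unbundle cross3_syntax

section \<open>Frames and rotations in space\<close>

text \<open>
  As \<open>y\<close> is orthogonal to the unit vector \<open>e\<close>, it equals \<open>e \<times> (y \<times> e)\<close>; rewriting the second
  \<open>e\<close> as \<open>w \<times> (e \<times> w)\<close> and applying Lagrange's identity yields the coordinates of \<open>y\<close>.
\<close>

lemma orthonormal_frame_expansion:
  fixes e w y :: "real^3"
  assumes "norm e = 1" "norm w = 1" "e \<bullet> w = 0" "e \<bullet> y = 0"
  shows "y = (w \<bullet> y) *\<^sub>R w + ((e \<times> w) \<bullet> y) *\<^sub>R (e \<times> w)"
proof -
  have "e \<bullet> e = 1" "w \<bullet> w = 1"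
    using assms(1,2) by (simp_all add: norm_eq_1)
  then have "w \<times> (e \<times> w) = e" and "e \<times> (e \<times> w) = - w"
    using assms(3) by (simp_all add: Lagrange inner_commute)
  have "y = e \<times> (y \<times> e)"
    using \<open>e \<bullet> e = 1\<close> assms(4) by (simp add: Lagrange)
  also have "y \<times> e = y \<times> (w \<times> (e \<times> w))"
    by (simp only: \<open>w \<times> (e \<times> w) = e\<close>)
  also have "\<dots> = (y \<bullet> (e \<times> w)) *\<^sub>R w - (y \<bullet> w) *\<^sub>R (e \<times> w)"
    by (rule Lagrange)
  also have "e \<times> \<dots> = (w \<bullet> y) *\<^sub>R w + ((e \<times> w) \<bullet> y) *\<^sub>R (e \<times> w)"
    by (simp add: Cross3.right_diff_distrib cross_mult_right \<open>e \<times> (e \<times> w) = - w\<close> inner_commute)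
  finally show ?thesis .
qed

lemma cross_rotation_right:
  assumes "orthogonal_matrix A" "det A = 1"
  shows "(x v* A) \<times> (y v* A) = (x \<times> y) v* A"
  using cross_orthogonal_matrix[of "transpose A" x y] assms by (simp add: det_transpose)

lemma linear_row_action: "linear (\<lambda>x. x v* (A :: real^3^3))"
  by (rule linearI) (simp_all add: vector_matrix_left_distrib scaleR_vector_matrix_assoc)

section \<open>Orthogonal actions on space\<close>

locale orthogonal_action = group \<Gamma> for \<Gamma> (structure) +
  fixes \<phi> :: "'a \<Rightarrow> real^3^3"
  assumes rep: "orthogonal_rep \<Gamma> \<phi>"
begin

abbreviation act :: "real^3 \<Rightarrow> 'a \<Rightarrow> real^3" (infixl "\<cdot>" 75)
  where "y \<cdot> g \<equiv> y v* \<phi> g"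

lemma orthogonal: "g \<in> carrier \<Gamma> \<Longrightarrow> orthogonal_matrix (\<phi> g)"
  using rep by (auto simp: orthogonal_rep_def hom_def O3_def)

lemma rep_mult: "g \<in> carrier \<Gamma> \<Longrightarrow> h \<in> carrier \<Gamma> \<Longrightarrow> \<phi> (g \<otimes> h) = \<phi> g ** \<phi> h"
  using rep by (auto simp: orthogonal_rep_def hom_def O3_def)

lemma rep_one: "\<phi> \<one> = mat 1"
proof -
  have "\<phi> \<one> ** \<phi> \<one> = \<phi> \<one>"
    using rep_mult[of \<one> \<one>] by simp
  moreover have "transpose (\<phi> \<one>) ** \<phi> \<one> = mat 1"
    using orthogonal[of \<one>] by (simp add: orthogonal_matrix)
  ultimately show ?thesis
    by (metis matrix_mul_assoc matrix_mul_lid)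
qed

lemma act_one [simp]: "y \<cdot> \<one> = y"
  by (simp add: rep_one)

lemma act_mult: "g \<in> carrier \<Gamma> \<Longrightarrow> h \<in> carrier \<Gamma> \<Longrightarrow> y \<cdot> (g \<otimes> h) = y \<cdot> g \<cdot> h"
  by (simp add: rep_mult vector_matrix_mul_assoc)

lemma act_add [simp]: "(y + z) \<cdot> g = y \<cdot> g + z \<cdot> g"
  by (rule linear_add[OF linear_row_action])

lemma act_scaleR [simp]: "(c *\<^sub>R y) \<cdot> g = c *\<^sub>R (y \<cdot> g)"
  by (rule linear_scale[OF linear_row_action])

lemma act_inv [simp]:
  assumes "g \<in> carrier \<Gamma>"
  shows "y \<cdot> g \<cdot> (inv g) = y" "y \<cdot> (inv g) \<cdot> g = y"
  using assms by (simp_all flip: act_mult)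

lemma act_inner [simp]:
  assumes "g \<in> carrier \<Gamma>"
  shows "(y \<cdot> g) \<bullet> (z \<cdot> g) = y \<bullet> z"
proof -
  have "\<phi> g ** transpose (\<phi> g) = mat 1"
    using orthogonal[OF assms] by (simp add: orthogonal_matrix_def)
  have "(y \<cdot> g) \<bullet> (z \<cdot> g) = y \<bullet> (\<phi> g *v (z \<cdot> g))"
    using dot_lmul_matrix by blast
  also have "\<dots> = y \<bullet> (z v* (\<phi> g ** transpose (\<phi> g)))"
    by (simp flip: vector_matrix_mul_assoc)
  finally show ?thesis
    by (simp add: \<open>\<phi> g ** transpose (\<phi> g) = mat 1\<close>)
qed

lemma act_norm [simp]: "g \<in> carrier \<Gamma> \<Longrightarrow> norm (y \<cdot> g) = norm y"
  by (simp add: norm_eq_sqrt_inner)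

lemma faithful_eqI:
  assumes "faithful_rep \<Gamma> \<phi>" "g \<in> carrier \<Gamma>" "h \<in> carrier \<Gamma>" "\<And>y. y \<cdot> g = y \<cdot> h"
  shows "g = h"
proof -
  have "transpose (\<phi> g) = transpose (\<phi> h)"
    using assms(4) by (simp only: matrix_eq transpose_matrix_vector) simp
  then have "\<phi> g = \<phi> h"
    by (metis transpose_transpose)
  with assms show ?thesis
    by (auto simp: faithful_rep_def inj_on_def)
qed

section \<open>Rotations about an axis\<close>

definition stabilizer :: "real^3 \<Rightarrow> 'a set"
  where "stabilizer e = {g \<in> carrier \<Gamma>. e \<cdot> g = e}"

definition rotations :: "real^3 \<Rightarrow> 'a set"
  where "rotations e = {g \<in> stabilizer e. det (\<phi> g) = 1}"

text \<open>
  For a rotation \<open>g\<close> about \<open>e\<close> and a unit vector \<open>w\<close> orthogonal to \<open>e\<close>, this is \<open>cis \<theta>\<close>, where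
  \<open>\<theta>\<close> is the angle of rotation: the plane orthogonal to \<open>e\<close> is identified with the complex
  numbers by sending \<open>w\<close> to \<open>1\<close> and \<open>e \<times> w\<close> to \<open>\<i>\<close>.
\<close>

definition rotation_number :: "real^3 \<Rightarrow> real^3 \<Rightarrow> 'a \<Rightarrow> complex"
  where "rotation_number e w g = Complex (w \<bullet> (w \<cdot> g)) ((e \<times> w) \<bullet> (w \<cdot> g))"

lemma stabilizer_inv: "g \<in> stabilizer e \<Longrightarrow> inv g \<in> stabilizer e"
  unfolding stabilizer_def by (auto) (metis act_inv(1))

lemma subgroup_stabilizer: "subgroup (stabilizer e) \<Gamma>"
proof
  fix g assume "g \<in> stabilizer e"
  then show "inv g \<in> stabilizer e"
    by (rule stabilizer_inv)
qed (auto simp: stabilizer_def act_mult)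

lemma det_rep_mult: "g \<in> carrier \<Gamma> \<Longrightarrow> h \<in> carrier \<Gamma> \<Longrightarrow> det (\<phi> (g \<otimes> h)) = det (\<phi> g) * det (\<phi> h)"
  by (simp add: rep_mult det_mul)

lemma subgroup_rotations: "subgroup (rotations e) \<Gamma>"
proof
  fix g assume "g \<in> rotations e"
  then have g: "g \<in> stabilizer e" "det (\<phi> g) = 1" "g \<in> carrier \<Gamma>"
    by (auto simp: rotations_def stabilizer_def)
  have "det (\<phi> g) * det (\<phi> (inv g)) = 1"
    using g(3) by (simp add: det_rep_mult[symmetric] rep_one det_I)
  then show "inv g \<in> rotations e"
    using g by (simp add: rotations_def stabilizer_inv)
qed (auto simp: rotations_def stabilizer_def act_mult det_rep_mult rep_one det_I)

context
  fixes e w :: "real^3"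
  assumes frame: "norm e = 1" "norm w = 1" "e \<bullet> w = 0"
begin

text \<open>
  The coordinates of the image of \<open>w\<close> are those of its rotation number by definition. The image
  of \<open>e \<times> w\<close> is then determined, because a rotation preserves cross products and fixes \<open>e\<close>.
\<close>

lemma rotation_frame:
  assumes "g \<in> rotations e"
  shows "w \<cdot> g = Re (rotation_number e w g) *\<^sub>R w + Im (rotation_number e w g) *\<^sub>R (e \<times> w)"
    and "(e \<times> w) \<cdot> g = Re (rotation_number e w g) *\<^sub>R (e \<times> w) - Im (rotation_number e w g) *\<^sub>R w"
proof -
  have g: "g \<in> carrier \<Gamma>" "e \<cdot> g = e" "det (\<phi> g) = 1"
    using assms by (auto simp: rotations_def stabilizer_def)
  have "e \<bullet> (w \<cdot> g) = 0"
    using act_inner[OF g(1), of e w] g(2) frame(3) by simp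
  from orthonormal_frame_expansion[OF frame this]
  show 1: "w \<cdot> g = Re (rotation_number e w g) *\<^sub>R w + Im (rotation_number e w g) *\<^sub>R (e \<times> w)"
    by (simp add: rotation_number_def)
  have "e \<bullet> e = 1"
    using frame(1) by (simp add: norm_eq_1)
  have "(e \<times> w) \<cdot> g = e \<times> (w \<cdot> g)"
    using cross_rotation_right[OF orthogonal[OF g(1)] g(3), of e w] g(2) by simp
  also have "\<dots> = Re (rotation_number e w g) *\<^sub>R (e \<times> w) - Im (rotation_number e w g) *\<^sub>R w"
    by (subst 1)
       (simp add: cross_add_right cross_mult_right Lagrange frame(3) \<open>e \<bullet> e = 1\<close>)
  finally show "(e \<times> w) \<cdot> g = Re (rotation_number e w g) *\<^sub>R (e \<times> w) - Im (rotation_number e w g) *\<^sub>R w" .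
qed

lemma rotation_number_mult:
  assumes "g \<in> rotations e" "h \<in> rotations e"
  shows "rotation_number e w (g \<otimes> h) = rotation_number e w g * rotation_number e w h"
proof -
  have carr: "g \<in> carrier \<Gamma>" "h \<in> carrier \<Gamma>"
    using assms by (auto simp: rotations_def stabilizer_def)
  let ?a = "Re (rotation_number e w g)" and ?b = "Im (rotation_number e w g)"
  let ?c = "Re (rotation_number e w h)" and ?d = "Im (rotation_number e w h)"
  have ww: "w \<bullet> w = 1" "w \<bullet> (e \<times> w) = 0" "(e \<times> w) \<bullet> w = 0"
    using frame(2) by (simp_all add: norm_eq_1 dot_cross_self)
  have "(e \<times> w) \<bullet> (e \<times> w) = 1"
    using norm_cross_dot[of e w] frame by (simp add: dot_square_norm)
  have "w \<cdot> (g \<otimes> h) = ?a *\<^sub>R (w \<cdot> h) + ?b *\<^sub>R ((e \<times> w) \<cdot> h)"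
    using rotation_frame(1)[OF assms(1)]
    by (simp add: act_mult[OF carr])
  also have "\<dots> = (?a * ?c - ?b * ?d) *\<^sub>R w + (?a * ?d + ?b * ?c) *\<^sub>R (e \<times> w)"
    unfolding rotation_frame[OF assms(2)] by (simp add: algebra_simps)
  finally show ?thesis
    unfolding rotation_number_def[of e w "g \<otimes> h"]
    by (simp add: complex_eq_iff inner_add_right ww \<open>(e \<times> w) \<bullet> (e \<times> w) = 1\<close>)
qed

lemma inj_on_rotation_number:
  assumes "faithful_rep \<Gamma> \<phi>"
  shows "inj_on (rotation_number e w) (rotations e)"
proof (rule inj_onI)
  fix g h
  assume gh: "g \<in> rotations e" "h \<in> rotations e" "rotation_number e w g = rotation_number e w h"
  then have carr: "g \<in> carrier \<Gamma>" "h \<in> carrier \<Gamma>" and fx: "e \<cdot> g = e" "e \<cdot> h = e"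
    by (auto simp: rotations_def stabilizer_def)
  have "y \<cdot> g = y \<cdot> h" for y
  proof -
    define z where "z = y - (e \<bullet> y) *\<^sub>R e"
    have "e \<bullet> e = 1"
      using frame(1) by (simp add: norm_eq_1)
    then have "e \<bullet> z = 0"
      by (simp add: z_def inner_diff_right)
    note z = orthonormal_frame_expansion[OF frame this]
    have "z \<cdot> g = z \<cdot> h"
      by (subst (1 2) z) (simp add: rotation_frame gh)
    moreover have "y = (e \<bullet> y) *\<^sub>R e + z"
      by (simp add: z_def)
    ultimately show ?thesis
      by (metis (no_types, lifting) act_add act_scaleR fx)
  qed
  with assms carr show "g = h"
    by (blast intro: faithful_eqI)
qed

lemma rotation_number_one: "rotation_number e w \<one> = 1"
  using frame(2) by (simp add: rotation_number_def norm_eq_1 dot_cross_self complex_eq_iff)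

text \<open>
  By Lagrange's theorem every rotation number is an \<open>n\<close>-th root of unity, where \<open>n\<close> is the
  number of rotations. There are only \<open>n\<close> such roots and rotation numbers are distinct, so
  every root occurs; in particular the group contains the rotation by \<open>2 * pi / n\<close>.
\<close>

lemma rotation_numbers_roots_of_unity:
  assumes "faithful_rep \<Gamma> \<phi>" "finite (carrier \<Gamma>)"
  shows "rotation_number e w ` rotations e = {z. z ^ card (rotations e) = 1}"
proof (rule card_subset_eq)
  let ?n = "card (rotations e)" and ?C = "\<Gamma>\<lparr>carrier := rotations e\<rparr>"
  interpret C: group ?C
    by (rule subgroup_imp_group[OF subgroup_rotations])
  have "finite (rotations e)"
    by (rule finite_subset[OF _ assms(2)]) (auto simp: rotations_def stabilizer_def)
  moreover have "\<one> \<in> rotations e"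
    using subgroup.one_closed[OF subgroup_rotations] .
  ultimately have n: "?n > 0"
    by (auto simp: card_gt_0_iff)
  then show "finite {z :: complex. z ^ ?n = 1}"
    using finite_roots_unity[of ?n] by simp
  show "card (rotation_number e w ` rotations e) = card {z :: complex. z ^ ?n = 1}"
    by (simp add: card_roots_unity_eq[OF n] card_image[OF inj_on_rotation_number[OF assms(1)]])
  show "rotation_number e w ` rotations e \<subseteq> {z. z ^ ?n = 1}"
  proof clarify
    fix g assume g: "g \<in> rotations e"
    have pow: "g [^]\<^bsub>?C\<^esub> m \<in> rotations e \<and>
               rotation_number e w (g [^]\<^bsub>?C\<^esub> m) = rotation_number e w g ^ m" for m :: nat
    proof (induction m)
      case 0
      show ?case
        using subgroup.one_closed[OF subgroup_rotations] rotation_number_one by simp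
    next
      case (Suc m)
      then show ?case
        using subgroup.m_closed[OF subgroup_rotations _ g] rotation_number_mult[OF _ g] by simp
    qed
    have "g [^]\<^bsub>?C\<^esub> ?n = \<one>"
      using C.pow_order_eq_1[of g] g by (simp add: order_def)
    then show "rotation_number e w g ^ ?n = 1"
      using pow[of ?n] rotation_number_one by simp
  qed
qed

end

text \<open>
  The rotation number of a nontrivial involutive rotation squares to \<open>1\<close> without being \<open>1\<close>, so
  it is \<open>-1\<close>: the element is the half-turn about \<open>e\<close>.
\<close>

lemma involutive_rotation_unique:
  assumes "faithful_rep \<Gamma> \<phi>" "norm e = 1"
    and "g \<in> rotations e" "h \<in> rotations e"
    and "g \<otimes> g = \<one>" "h \<otimes> h = \<one>" "g \<noteq> \<one>" "h \<noteq> \<one>"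
  shows "g = h"
proof -
  obtain u where "u \<noteq> 0" "orthogonal e u"
    using orthogonal_to_vector_exists[of e] by auto
  define w where "w = u /\<^sub>R norm u"
  have frame: "norm e = 1" "norm w = 1" "e \<bullet> w = 0"
    using assms(2) \<open>u \<noteq> 0\<close> \<open>orthogonal e u\<close> by (simp_all add: w_def orthogonal_def)
  have "rotation_number e w k = -1" if "k \<in> rotations e" "k \<otimes> k = \<one>" "k \<noteq> \<one>" for k
  proof -
    have "rotation_number e w k * rotation_number e w k = 1"
      using rotation_number_mult[OF frame that(1) that(1)] that(2) rotation_number_one[OF frame]
      by simp
    moreover have "rotation_number e w k \<noteq> rotation_number e w \<one>"
      using inj_on_rotation_number[OF frame assms(1)] that subgroup.one_closed[OF subgroup_rotations]
      by (auto dest: inj_onD)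
    ultimately show ?thesis
      using rotation_number_one[OF frame] by (simp add: square_eq_1_iff)
  qed
  then have "rotation_number e w g = rotation_number e w h"
    using assms by simp
  then show ?thesis
    by (rule inj_onD[OF inj_on_rotation_number[OF frame assms(1)] _ assms(3,4)])
qed

text \<open>
  The bound comes from \<open>cos (2 * pi / n) \<ge> 1 / 2\<close> for \<open>n \<ge> 6\<close>: an orbit point \<open>y\<close> off the axis
  of \<open>e\<close> is at squared distance \<open>2 - 2 * c\<close> from \<open>e\<close>, where \<open>c = e \<bullet> y\<close>, whereas the rotation
  by \<open>2 * pi / n\<close> moves \<open>y\<close> by a squared distance of at most \<open>1 - c\<^sup>2\<close>, which is smaller since
  \<open>c < 1\<close>. On the unit sphere closeness is measured by the inner product.
\<close>

lemma card_rotations_le_5: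
  assumes "faithful_rep \<Gamma> \<phi>" "irreducible_rep \<Gamma> \<phi>" "finite (carrier \<Gamma>)" "norm e = 1"
  shows "card (rotations e) \<le> 5"
proof (rule ccontr)
  assume "\<not> ?thesis"
  then have n: "card (rotations e) \<ge> 6"
    by simp
  define orbit where "orbit = (\<lambda>g. e \<cdot> g) ` carrier \<Gamma>"
  have norm_orbit: "norm y = 1" if "y \<in> orbit" for y
    using that assms(4) by (auto simp: orbit_def)
  have "orbit - {e, -e} \<noteq> {}"
  proof
    assume "orbit - {e, -e} = {}"
    have "e \<cdot> g \<in> span {e}" if "g \<in> carrier \<Gamma>" for g
    proof -
      have "e \<cdot> g = e \<or> e \<cdot> g = - e"
        using \<open>orbit - {e, -e} = {}\<close> that by (auto simp: orbit_def)
      then show ?thesis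
        using span_base[of e "{e}"] span_neg[of e "{e}"] by auto
    qed
    note orbit_line = this
    have "image_under (span {e}) (\<phi> g) \<subseteq> span {e}" if "g \<in> carrier \<Gamma>" for g
    proof -
      have "(k *\<^sub>R e) \<cdot> g \<in> span {e}" for k
        unfolding act_scaleR by (rule span_scale[OF orbit_line[OF that]])
      then show ?thesis
        by (auto simp: image_under_def span_singleton[of e])
    qed
    then have "span {e} = {0} \<or> span {e} = UNIV"
      using assms(2) by (simp add: irreducible_rep_def)
    moreover have "e \<in> span {e}" "e \<noteq> 0"
      using assms(4) by (auto simp: span_base)
    moreover have "span {e} \<noteq> UNIV"
    proof
      assume "span {e} = UNIV"
      then have "dim {e} = dim (UNIV :: (real^3) set)"
        by (metis dim_span)
      then show False
        by (simp add: dim_singleton split: if_splits)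
    qed
    ultimately show False
      by auto
  qed
  moreover have "finite orbit"
    using assms(3) by (simp add: orbit_def)
  ultimately obtain y where y: "y \<in> orbit - {e, -e}" and max: "\<And>z. z \<in> orbit - {e, -e} \<Longrightarrow> e \<bullet> z \<le> e \<bullet> y"
    using arg_min_if_finite[of "orbit - {e, -e}" "\<lambda>y. - (e \<bullet> y)"]
    by (metis (no_types, lifting) finite_Diff linorder_not_le neg_less_iff_less)
  \<comment> \<open>\<open>y\<close> is a point of the orbit, off the axis, that is as close to \<open>e\<close> as possible.\<close>
  define c where "c = e \<bullet> y"
  have sphere: "e \<bullet> e = 1" "y \<bullet> y = 1"
    using assms(4) y norm_orbit by (auto simp flip: norm_eq_1)
  have "\<bar>c\<bar> \<le> 1"
    using Cauchy_Schwarz_ineq2[of e y] assms(4) y norm_orbit by (simp add: c_def)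
  have "norm (y - c *\<^sub>R e) ^ 2 = 1 - c\<^sup>2"
    unfolding power2_norm_eq_inner
    by (simp add: inner_diff_left inner_diff_right sphere c_def inner_commute power2_eq_square)
  have "c \<noteq> 1" "c \<noteq> -1"
  proof -
    have "y = c *\<^sub>R e" if "c\<^sup>2 = 1"
      using that \<open>norm (y - c *\<^sub>R e) ^ 2 = 1 - c\<^sup>2\<close> by simp
    then show "c \<noteq> 1" "c \<noteq> -1"
      using y by auto
  qed
  then have c: "-1 < c" "c < 1"
    using \<open>\<bar>c\<bar> \<le> 1\<close> by auto
  \<comment> \<open>The frame is adapted to \<open>y\<close>, so that a single inner product records how far \<open>y\<close> is rotated.\<close>
  define s where "s = norm (y - c *\<^sub>R e)"
  define w where "w = (y - c *\<^sub>R e) /\<^sub>R s"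
  have s: "s\<^sup>2 = 1 - c\<^sup>2"
    using \<open>norm (y - c *\<^sub>R e) ^ 2 = 1 - c\<^sup>2\<close> by (simp add: s_def)
  have "c\<^sup>2 < 1"
    using c by (simp add: abs_square_less_1)
  then have "s \<noteq> 0"
    using s by auto
  then have y_eq: "y = c *\<^sub>R e + s *\<^sub>R w"
    by (simp add: w_def)
  have frame: "norm e = 1" "norm w = 1" "e \<bullet> w = 0"
    using assms(4) \<open>s \<noteq> 0\<close> sphere by (auto simp: w_def s_def inner_diff_right c_def)
  define a where "a = cos (2 * pi / card (rotations e))"
  have "cis (2 * pi / card (rotations e)) ^ card (rotations e) = 1"
    using n by (subst Complex.DeMoivre) auto
  then obtain r where r: "r \<in> rotations e" "rotation_number e w r = cis (2 * pi / card (rotations e))"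
    using rotation_numbers_roots_of_unity[OF frame assms(1,3)] by (metis (mono_tags, lifting) imageE mem_Collect_eq)
  then have rc: "r \<in> carrier \<Gamma>" "e \<cdot> r = e"
    by (auto simp: rotations_def stabilizer_def)
  have ang: "2 * pi / card (rotations e) \<le> pi / 3" "0 < 2 * pi / card (rotations e)"
    using n by (auto simp: field_simps)
  have "a \<ge> cos (pi / 3)"
    unfolding a_def using ang pi_gt_zero by (intro cos_monotone_0_pi_le) auto
  moreover have "a < cos 0"
    unfolding a_def using ang pi_gt_zero by (intro cos_monotone_0_pi) auto
  ultimately have a: "a \<ge> 1 / 2" "a < 1"
    by (auto simp: cos_60)
  have "w \<bullet> (w \<cdot> r) = a"
    using arg_cong[OF r(2), of Re] by (simp add: rotation_number_def a_def)
  moreover have "e \<bullet> (w \<cdot> r) = 0"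
    using act_inner[OF rc(1), of e w] rc(2) frame(3) by simp
  ultimately have "y \<bullet> (y \<cdot> r) = c\<^sup>2 + s\<^sup>2 * a"
    unfolding y_eq using sphere frame(3) rc(2)
    by (simp add: inner_add_left inner_add_right inner_commute power2_eq_square)
  obtain g where g: "g \<in> carrier \<Gamma>" "y = e \<cdot> g"
    using y by (auto simp: orbit_def)
  \<comment> \<open>The isometry taking \<open>y\<close> back to \<open>e\<close> takes the rotated point to \<open>z\<close>,
  so \<open>z\<close> lies at the same distance from \<open>e\<close> as the rotated point from \<open>y\<close>.\<close>
  define z where "z = e \<cdot> (g \<otimes> r \<otimes> inv g)"
  have "z \<cdot> g = y \<cdot> r"
    using g rc by (simp add: z_def act_mult)
  then have ez: "e \<bullet> z = c\<^sup>2 + s\<^sup>2 * a"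
    using act_inner[OF g(1), of e z] g(2) \<open>y \<bullet> (y \<cdot> r) = c\<^sup>2 + s\<^sup>2 * a\<close> by simp
  have "s\<^sup>2 > 0"
    using \<open>s \<noteq> 0\<close> by simp
  have "e \<bullet> z < 1"
    using mult_strict_left_mono[OF a(2) \<open>s\<^sup>2 > 0\<close>] unfolding ez s by simp
  moreover have "e \<bullet> z > c"
  proof -
    have "(1 - c)\<^sup>2 > 0"
      using c by simp
    then have "2 * c < 1 + c\<^sup>2"
      by (simp add: power2_eq_square algebra_simps)
    then have "c < c\<^sup>2 + s\<^sup>2 * (1 / 2)"
      unfolding s by (simp add: field_simps)
    also have "\<dots> \<le> c\<^sup>2 + s\<^sup>2 * a"
      using mult_left_mono[OF a(1), of "s\<^sup>2"] by simp
    finally show ?thesis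
      unfolding ez .
  qed
  moreover have "z \<in> orbit"
    using g rc by (auto simp: z_def orbit_def)
  moreover have "z \<noteq> e" "z \<noteq> - e"
    using \<open>e \<bullet> z < 1\<close> \<open>e \<bullet> z > c\<close> c(1) sphere(1) by auto
  ultimately show False
    using max[of z] by (simp add: c_def)
qed

section \<open>Stabilizers of points fixed by two involutions\<close>

text \<open>
  The fixed space of a central element is invariant under the whole group, as in Schur's lemma;
  containing \<open>e \<noteq> 0\<close>, it is the whole space by irreducibility.
\<close>

lemma central_fixing_vector_imp_one:
  assumes "faithful_rep \<Gamma> \<phi>" "irreducible_rep \<Gamma> \<phi>" "g \<in> carrier \<Gamma>"
    and "\<And>h. h \<in> carrier \<Gamma> \<Longrightarrow> h \<otimes> g = g \<otimes> h" "e \<cdot> g = e" "e \<noteq> 0"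
  shows "g = \<one>"
proof -
  let ?V = "{y. y \<cdot> g = y}"
  have "subspace ?V"
    by (auto simp: subspace_def)
  moreover have "image_under ?V (\<phi> h) \<subseteq> ?V" if "h \<in> carrier \<Gamma>" for h
    using that assms(3) assms(4)[OF that]
    by (auto simp: image_under_def) (metis act_mult)
  ultimately have "?V = {0} \<or> ?V = UNIV"
    using assms(2) unfolding irreducible_rep_def by blast
  then have "?V = UNIV"
    using assms(5,6) by auto
  then show ?thesis
    using assms(1,3) by (intro faithful_eqI) auto
qed

text \<open>
  If an involution fixing \<open>e\<close> had determinant \<open>1\<close>, it would be the half-turn about \<open>e\<close>, and so
  would its conjugates within the stabilizer; it would commute with everything there. Hence \<open>a\<close>
  and \<open>b\<close> have determinant \<open>-1\<close>, their product \<open>s\<close> is a rotation, and \<open>\<one>\<close>, \<open>s\<close>, \<open>s \<otimes> s\<close> are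
  distinct because \<open>s\<close> differs from its inverse \<open>b \<otimes> a\<close>. An element outside the generated group
  leads to a rotation \<open>r\<close> outside it, and then to the six rotations \<open>d\<close>, \<open>r \<otimes> d\<close> with \<open>d\<close> among
  those three.
\<close>

lemma stabilizer_eq_generate_involutions:
  assumes faithful: "faithful_rep \<Gamma> \<phi>" and irred: "irreducible_rep \<Gamma> \<phi>"
    and fin: "finite (carrier \<Gamma>)" and "norm e = 1"
    and a: "a \<in> stabilizer e" "a \<otimes> a = \<one>" and b: "b \<in> stabilizer e" "b \<otimes> b = \<one>"
    and noncomm: "a \<otimes> b \<noteq> b \<otimes> a"
  shows "stabilizer e = generate \<Gamma> {a, b}"
proof
  have carr: "a \<in> carrier \<Gamma>" "b \<in> carrier \<Gamma>"
    using a b by (auto simp: stabilizer_def)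
  show K_sub: "generate \<Gamma> {a, b} \<subseteq> stabilizer e"
    using a b by (intro generate_subgroup_incl subgroup_stabilizer) auto
  have det_invol: "det (\<phi> g) * det (\<phi> g) = 1" if "g \<in> carrier \<Gamma>" "g \<otimes> g = \<one>" for g
    using det_rep_mult[of g g] that by (simp add: rep_one det_I)
  \<comment> \<open>The conjugate \<open>h \<otimes> g \<otimes> h\<close> of a half-turn \<open>g\<close> is again a half-turn about \<open>e\<close>, hence equal to \<open>g\<close>.\<close>
  have reflection: "det (\<phi> g) = -1"
    if g: "g \<in> stabilizer e" "g \<otimes> g = \<one>" and h: "h \<in> stabilizer e" "h \<otimes> h = \<one>"
      and "g \<otimes> h \<noteq> h \<otimes> g" for g h
  proof (rule ccontr)
    assume "det (\<phi> g) \<noteq> -1"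
    have c: "g \<in> carrier \<Gamma>" "h \<in> carrier \<Gamma>"
      using g h by (auto simp: stabilizer_def)
    then have "det (\<phi> g) = 1"
      using \<open>det (\<phi> g) \<noteq> -1\<close> orthogonal[of g] det_orthogonal_matrix[of "\<phi> g"] by auto
    then have "g \<in> rotations e"
      using g by (simp add: rotations_def)
    moreover have "h \<otimes> g \<otimes> h \<in> rotations e"
      using det_invol[OF c(2) h(2)] \<open>det (\<phi> g) = 1\<close> c
        subgroup.m_closed[OF subgroup_stabilizer] g h
      by (simp add: rotations_def det_rep_mult)
    moreover have "h \<otimes> g \<otimes> h \<otimes> (h \<otimes> g \<otimes> h) = \<one>"
    proof -
      have "h \<otimes> g \<otimes> h \<otimes> (h \<otimes> g \<otimes> h) = h \<otimes> (g \<otimes> ((h \<otimes> h) \<otimes> (g \<otimes> h)))"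
        using c by (simp add: m_assoc)
      also have "\<dots> = h \<otimes> ((g \<otimes> g) \<otimes> h)"
        using c h(2) by (simp add: m_assoc)
      finally show ?thesis
        using c g(2) h(2) by simp
    qed
    moreover have "g \<noteq> \<one>"
      using that(5) c by auto
    moreover have cancel: "h \<otimes> g \<otimes> h \<otimes> h = h \<otimes> g"
      using c h(2) by (simp add: m_assoc)
    moreover have "h \<otimes> g \<otimes> h \<noteq> \<one>"
    proof
      assume "h \<otimes> g \<otimes> h = \<one>"
      then have "h \<otimes> g = h"
        using cancel c by simp
      then show False
        using \<open>g \<noteq> \<one>\<close> c by simp
    qed
    ultimately have "g = h \<otimes> g \<otimes> h"
      using involutive_rotation_unique[OF faithful \<open>norm e = 1\<close>] g(2) by blast
    then have "g \<otimes> h = h \<otimes> g"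
      using cancel by simp
    with that(5) show False ..
  qed
  have dets: "det (\<phi> a) = -1" "det (\<phi> b) = -1"
    using reflection[OF a b] reflection[OF b a] noncomm by auto
  define s where "s = a \<otimes> b"
  define D where "D = {\<one>, s, s \<otimes> s}"
  have s: "s \<in> rotations e" "s \<in> carrier \<Gamma>"
    using subgroup.m_closed[OF subgroup_stabilizer a(1) b(1)] dets carr
    by (auto simp: s_def rotations_def det_rep_mult)
  have inv_ab: "inv a = a" "inv b = b"
    using a(2) b(2) carr by (simp_all add: inv_equality)
  have "s \<noteq> inv s"
    using noncomm carr by (simp add: s_def inv_mult_group inv_ab)
  then have "s \<otimes> s \<noteq> \<one>" "s \<noteq> \<one>"
    using s(2) inv_equality[of s s] by auto
  then have "card D = 3"
    using s(2) by (auto simp: D_def)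
  have D_rot: "D \<subseteq> rotations e"
    using s subgroup.one_closed[OF subgroup_rotations] subgroup.m_closed[OF subgroup_rotations]
    by (auto simp: D_def)
  have K: "subgroup (generate \<Gamma> {a, b}) \<Gamma>"
    using carr by (intro generate_is_subgroup) auto
  have ab_K: "a \<in> generate \<Gamma> {a, b}" "b \<in> generate \<Gamma> {a, b}"
    by (auto intro: generate.incl)
  have D_K: "D \<subseteq> generate \<Gamma> {a, b}"
    unfolding D_def s_def using ab_K K by (auto intro!: subgroup.m_closed subgroup.one_closed)
  show "stabilizer e \<subseteq> generate \<Gamma> {a, b}"
  proof (rule ccontr)
    assume "\<not> ?thesis"
    then obtain h where h: "h \<in> stabilizer e" "h \<notin> generate \<Gamma> {a, b}"
      by auto
    \<comment> \<open>If \<open>h\<close> reverses orientation, composing it with the reflection \<open>a\<close> gives a rotation.\<close>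
    obtain r where r: "r \<in> rotations e" "r \<notin> generate \<Gamma> {a, b}"
    proof (cases "det (\<phi> h) = 1")
      case True
      then show ?thesis
        using that[of h] h by (simp add: rotations_def)
    next
      case False
      have hc: "h \<in> carrier \<Gamma>"
        using h(1) by (simp add: stabilizer_def)
      then have "det (\<phi> h) = -1"
        using False orthogonal[of h] det_orthogonal_matrix[of "\<phi> h"] by auto
      then have "h \<otimes> a \<in> rotations e"
        using subgroup.m_closed[OF subgroup_stabilizer h(1) a(1)] dets carr hc
        by (simp add: rotations_def det_rep_mult)
      moreover have "h \<otimes> a \<otimes> a = h"
        using hc carr a(2) by (simp add: m_assoc)
      then have "h \<otimes> a \<notin> generate \<Gamma> {a, b}"
        using h(2) subgroup.m_closed[OF K _ ab_K(1)] by metis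
      ultimately show ?thesis
        by (rule that)
    qed
    have rc: "r \<in> carrier \<Gamma>" and Dc: "D \<subseteq> carrier \<Gamma>"
      using r(1) s(2) by (auto simp: rotations_def stabilizer_def D_def)
    have "card ((\<lambda>d. r \<otimes> d) ` D) = 3"
      using \<open>card D = 3\<close> rc Dc
      by (subst card_image) (auto intro!: inj_onI dest: subsetD simp: subset_iff)
    moreover have "D \<inter> (\<lambda>d. r \<otimes> d) ` D = {}"
    proof -
      have "r \<otimes> d \<notin> D" if "d \<in> D" for d
      proof
        assume "r \<otimes> d \<in> D"
        then have "r \<otimes> d \<in> generate \<Gamma> {a, b}" "inv d \<in> generate \<Gamma> {a, b}"
          using D_K that subgroup.m_inv_closed[OF K] by auto
        then have "r \<otimes> d \<otimes> inv d \<in> generate \<Gamma> {a, b}"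
          by (rule subgroup.m_closed[OF K])
        then show False
          using rc Dc that r(2) by (auto simp: m_assoc)
      qed
      then show ?thesis
        by auto
    qed
    ultimately have "card (D \<union> (\<lambda>d. r \<otimes> d) ` D) = 6"
      using \<open>card D = 3\<close> by (subst card_Un_disjoint) (auto simp: D_def)
    moreover have "D \<union> (\<lambda>d. r \<otimes> d) ` D \<subseteq> rotations e"
      using D_rot r(1) subgroup.m_closed[OF subgroup_rotations] by auto
    moreover have "finite (rotations e)"
      by (rule finite_subset[OF _ fin]) (auto simp: rotations_def stabilizer_def)
    ultimately have "6 \<le> card (rotations e)"
      using card_mono by metis
    then show False
      using card_rotations_le_5[OF faithful irred fin \<open>norm e = 1\<close>] by simp
  qed
qed

lemma stabilizer_scaleR: "c \<noteq> 0 \<Longrightarrow> stabilizer (c *\<^sub>R y) = stabilizer y"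
  by (simp add: stabilizer_def)

lemma wythoff_generators_subset_stabilizer:
  assumes "t ` {0..2::int} \<subseteq> carrier \<Gamma>" "x \<in> wythoff_space \<phi> t"
  shows "{t 1, t 2} \<subseteq> stabilizer x"
  using assms by (auto simp: wythoff_space_def stabilizer_def)

lemma vertex_group_eq: "face_group \<Gamma> t 0 = generate \<Gamma> {t 1, t 2}"
proof -
  have "{0..2} - {0} = {1, 2 :: int}"
    by auto
  then show ?thesis
    by (simp add: face_group_def)
qed

text \<open>
  \<open>stabilizer_eq_generate_involutions\<close>, applied to the normalized \<open>x\<close>, gives the result once
  \<open>t 1\<close> and \<open>t 2\<close> are known not to commute. If they did, \<open>t 2\<close> would commute with all three
  generators, hence be central while fixing \<open>x\<close>.
\<close>

lemma stabilizer_wythoff_point: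
  assumes C: "string_C_group \<Gamma> t p q"
    and faithful: "faithful_rep \<Gamma> \<phi>" and irred: "irreducible_rep \<Gamma> \<phi>"
    and x: "x \<in> wythoff_space \<phi> t" "x \<noteq> 0"
  shows "stabilizer x = face_group \<Gamma> t 0"
proof -
  have gens: "t ` {0..2} \<subseteq> carrier \<Gamma>" and fin: "finite (carrier \<Gamma>)"
    and generated: "generate \<Gamma> (t ` {0..2}) = carrier \<Gamma>"
    and commute02: "t 0 \<otimes> t 2 = t 2 \<otimes> t 0"
    and invol: "\<And>k. k \<in> {0..2} \<Longrightarrow> t k \<noteq> \<one> \<and> t k \<otimes> t k = \<one>"
    using C by (auto simp: string_C_group_def)
  have carr: "t 0 \<in> carrier \<Gamma>" "t 1 \<in> carrier \<Gamma>" "t 2 \<in> carrier \<Gamma>"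
    using gens by auto
  have "t 1 \<otimes> t 2 \<noteq> t 2 \<otimes> t 1"
  proof
    assume commute12: "t 1 \<otimes> t 2 = t 2 \<otimes> t 1"
    have "t ` {0..2} = {t 0, t 1, t 2}"
    proof -
      have "{0..2} = {0, 1, 2 :: int}"
        by auto
      then show ?thesis
        by simp
    qed
    then have generators_commute: "k \<otimes> t 2 = t 2 \<otimes> k \<and> inv k = k" if "k \<in> t ` {0..2}" for k
      using that commute02 commute12 invol carr by (auto intro!: inv_equality)
    have "h \<otimes> t 2 = t 2 \<otimes> h" if "h \<in> generate \<Gamma> (t ` {0..2})" for h
      using that
    proof (induction rule: generate.induct)
      case (eng g h)
      have "g \<in> carrier \<Gamma>" "h \<in> carrier \<Gamma>"
        using eng.hyps generated by auto
      with eng.IH carr(3) show ?case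
        by (metis m_assoc)
    qed (use carr generators_commute in auto)
    then have "t 2 = \<one>"
      using central_fixing_vector_imp_one[OF faithful irred carr(3), of x] x generated
      by (simp add: wythoff_space_def)
    then show False
      using invol[of 2] by simp
  qed
  moreover define e where "e = (1 / norm x) *\<^sub>R x"
  have stab: "stabilizer e = stabilizer x" and "norm e = 1"
    using x(2) by (simp_all add: e_def stabilizer_scaleR)
  ultimately have "stabilizer e = generate \<Gamma> {t 1, t 2}"
    using wythoff_generators_subset_stabilizer[OF gens x(1)] invol[of 1] invol[of 2]
    by (intro stabilizer_eq_generate_involutions[OF faithful irred fin]) auto
  then show ?thesis
    by (simp add: stab vertex_group_eq)
qed

section \<open>Images of open sets under isometries\<close>

lemma image_under_one [simp]: "image_under S (\<phi> \<one>) = S"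
  by (simp add: image_under_def)

lemma image_under_mult:
  "g \<in> carrier \<Gamma> \<Longrightarrow> h \<in> carrier \<Gamma> \<Longrightarrow>
     image_under S (\<phi> (g \<otimes> h)) = image_under (image_under S (\<phi> g)) (\<phi> h)"
  by (simp add: image_under_def act_mult image_image)

lemma inj_act: "g \<in> carrier \<Gamma> \<Longrightarrow> inj (\<lambda>y. y \<cdot> g)"
  by (rule inj_on_inverseI[of _ "\<lambda>y. y \<cdot> inv g"]) simp

lemma boundary_image_under:
  assumes "g \<in> carrier \<Gamma>"
  shows "boundary (image_under S (\<phi> g)) = image_under (boundary S) (\<phi> g)"
  using closure_injective_linear_image[OF linear_row_action inj_act[OF assms], of S]
  by (simp add: boundary_def image_under_def image_set_diff[OF inj_act[OF assms]])

lemma open_set_of_dim_image_under: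
  assumes "g \<in> carrier \<Gamma>" "open_set_of_dim n S"
  shows "open_set_of_dim n (image_under S (\<phi> g))"
proof -
  have "homeomorphic_maps (top_of_set S) (top_of_set (image_under S (\<phi> g))) (\<lambda>y. y \<cdot> g) (\<lambda>y. y \<cdot> inv g)"
    using assms(1)
    by (auto simp: homeomorphic_maps_def image_under_def
        intro!: linear_continuous_on linear_row_action[unfolded linear_conv_bounded_linear])
  then have "top_of_set (image_under S (\<phi> g)) homeomorphic_space top_of_set S"
    using homeomorphic_maps_imp_homeomorphic_space homeomorphic_space_sym by blast
  then show ?thesis
    using assms(2) homeomorphic_space_trans unfolding open_set_of_dim_def by blast
qed

end

text \<open>
  \<open>Euclidean_space 0\<close> consists of the zero sequence alone.
\<close>

lemma open_set_of_dim_point: "open_set_of_dim 0 {x}"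
proof -
  have top: "topspace (Euclidean_space 0) = {\<lambda>_. 0}"
    by (auto simp: topspace_Euclidean_space)
  have "homeomorphic_maps (top_of_set {x}) (Euclidean_space 0) (\<lambda>_ _. 0) (\<lambda>_. x)"
    using top by (auto simp: homeomorphic_maps_def)
  then have "top_of_set {x} homeomorphic_space subtopology (Euclidean_space 0) (topspace (Euclidean_space 0))"
    by (simp add: homeomorphic_maps_imp_homeomorphic_space)
  then show ?thesis
    unfolding open_set_of_dim_def by blast
qed

unbundle no cross3_syntax

section \<open>Cosets as faces\<close>

context group
begin

lemma subgroup_face_group:
  assumes "t ` {0..2} \<subseteq> carrier G"
  shows "subgroup (face_group G t i) G"
  using assms by (auto simp: face_group_def intro!: generate_is_subgroup subgroup_self)

lemma faces_of_rank_eq: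
  "i \<in> {-1..3} \<Longrightarrow> faces_of_rank G t i = (\<lambda>g. (i, face_group G t i #> g)) ` carrier G"
  by (auto simp: faces_of_rank_def faces_def RCOSETS_def)

lemma face_act_coset:
  assumes "t ` {0..2} \<subseteq> carrier G" "g \<in> carrier G" "h \<in> carrier G"
  shows "face_act G (i, face_group G t i #> g) h = (i, face_group G t i #> (g \<otimes> h))"
  using assms subgroup.subset[OF subgroup_face_group[OF assms(1)]]
  by (simp add: face_act_def coset_mult_assoc)

lemma face_act_faces_of_rank:
  assumes "t ` {0..2} \<subseteq> carrier G" "g \<in> carrier G" "i \<in> {-1..3}" "F \<in> faces_of_rank G t i"
  shows "face_act G F g \<in> faces_of_rank G t i"
  using assms by (auto simp: faces_of_rank_eq face_act_coset)

lemma face_act_inv: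
  assumes "t ` {0..2} \<subseteq> carrier G" "g \<in> carrier G" "i \<in> {-1..3}" "F \<in> faces_of_rank G t i"
  shows "face_act G (face_act G F (inv g)) g = F"
  using assms by (auto simp: faces_of_rank_eq face_act_coset m_assoc)

lemma face_le_face_act:
  assumes "snd H \<subseteq> carrier G" "snd F \<subseteq> carrier G" "g \<in> carrier G"
  shows "face_le (face_act G H g) (face_act G F g) \<longleftrightarrow> face_le H F"
proof -
  have "(snd H #> g) \<inter> (snd F #> g) = (snd H \<inter> snd F) #> g"
    using assms by (fastforce simp: r_coset_def)
  then show ?thesis
    by (auto simp: face_le_def face_act_def r_coset_def)
qed

lemma faces_of_rank_subset_carrier:
  assumes "t ` {0..2} \<subseteq> carrier G" "i \<in> {-1..3}" "F \<in> faces_of_rank G t i"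
  shows "snd F \<subseteq> carrier G"
  using assms subgroup.subset[OF subgroup_face_group[OF assms(1)]]
  by (fastforce simp: faces_of_rank_eq r_coset_def)

text \<open>
  Right multiplication by \<open>g\<close> is an automorphism of the coset poset, with inverse the
  multiplication by \<open>inv g\<close>.
\<close>

lemma lower_faces_face_act:
  assumes "t ` {0..2} \<subseteq> carrier G" "g \<in> carrier G" "k \<in> {-1..3}" "i \<in> {-1..3}"
    and F: "F \<in> faces_of_rank G t i"
  shows "{H \<in> faces_of_rank G t k. face_le H (face_act G F g)} =
         (\<lambda>H. face_act G H g) ` {H \<in> faces_of_rank G t k. face_le H F}" (is "?L = ?R")
proof
  note sub = faces_of_rank_subset_carrier[OF assms(1)]
  show "?R \<subseteq> ?L"
    using sub[OF assms(3)] sub[OF assms(4) F] assms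
    by (auto simp: face_le_face_act face_act_faces_of_rank)
  show "?L \<subseteq> ?R"
  proof
    fix H assume "H \<in> ?L"
    then have H: "H \<in> faces_of_rank G t k" "face_le H (face_act G F g)"
      by auto
    let ?H = "face_act G H (inv g)"
    have H': "?H \<in> faces_of_rank G t k" "face_act G ?H g = H"
      using assms H by (simp_all add: face_act_faces_of_rank face_act_inv)
    then have "face_le ?H F"
      using face_le_face_act[of ?H F g] sub[OF assms(3)] sub[OF assms(4) F] H(2) assms(2) by simp
    with H' show "H \<in> ?R"
      by (intro image_eqI[of _ _ ?H]) auto
  qed
qed

end

section \<open>Transporting base faces\<close>

text \<open>
  The construction from base sets \<open>B i\<close>, freed from the enumeration of the cosets: \<open>\<rho>_coset\<close>
  prescribes \<open>\<rho>\<close> for every representative \<open>g\<close> of a coset at once, which is consistent by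
  \<open>base_invariant\<close>.
\<close>

locale wythoff_construction = orthogonal_action +
  fixes t :: "int \<Rightarrow> 'a"
    and B :: "int \<Rightarrow> (real^3) set"
    and \<rho> :: "'a face \<Rightarrow> (real^3) set"
  assumes gens: "t ` {0..2} \<subseteq> carrier \<Gamma>"
    and base_invariant:
      "\<And>i g. i \<in> {0..3} \<Longrightarrow> g \<in> face_group \<Gamma> t i \<Longrightarrow> image_under (B i) (\<phi> g) = B i"
    and \<rho>_coset:
      "\<And>i g. i \<in> {0..3} \<Longrightarrow> g \<in> carrier \<Gamma> \<Longrightarrow> \<rho> (i, face_group \<Gamma> t i #> g) = image_under (B i) (\<phi> g)"
    and \<rho>_empty_face: "\<And>F. F \<in> faces_of_rank \<Gamma> t (-1) \<Longrightarrow> \<rho> F = {}"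
begin

lemma \<rho>_face_act:
  assumes "F \<in> faces_of_rank \<Gamma> t i" "i \<in> {-1..3}" "g \<in> carrier \<Gamma>"
  shows "\<rho> (face_act \<Gamma> F g) = image_under (\<rho> F) (\<phi> g)"
proof (cases "i = -1")
  case True
  then show ?thesis
    using assms \<rho>_empty_face face_act_faces_of_rank[OF gens] by (simp add: image_under_def)
next
  case False
  then have "i \<in> {0..3}"
    using assms(2) by auto
  moreover obtain h where "h \<in> carrier \<Gamma>" "F = (i, face_group \<Gamma> t i #> h)"
    using assms by (auto simp: faces_of_rank_eq)
  ultimately show ?thesis
    using assms(3) by (simp add: face_act_coset gens \<rho>_coset image_under_mult)
qed

text \<open>
  Every face is the image of a base face under some \<open>g\<close>, and \<open>\<phi> g\<close> carries the boundary of the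
  base set to the boundary of its image. The faces below a base face are carried to the faces
  below its image, so equivariance turns one boundary formula into the other.
\<close>

lemma symmetric_realization_transport:
  assumes "\<And>i. i \<in> {0..3} \<Longrightarrow> B i \<noteq> {}"
    and "\<And>i. i \<in> {0..3} \<Longrightarrow> open_set_of_dim (nat i) (B i)"
    and base_boundary: "\<And>i. i \<in> {0..3} \<Longrightarrow> boundary (B i) =
          (\<Union>k\<in>{0..<i}. \<Union>H\<in>{H \<in> faces_of_rank \<Gamma> t k. face_le H (i, face_group \<Gamma> t i)}. \<rho> H)"
  shows "symmetric_realization \<Gamma> t \<rho>"
proof -
  have "realization \<Gamma> t \<rho>"
    unfolding realization_def
  proof (intro conjI ballI)
    fix i :: int and F
    assume i: "i \<in> {0..3}" and "F \<in> faces_of_rank \<Gamma> t i"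
    then obtain g where g: "g \<in> carrier \<Gamma>" "F = (i, face_group \<Gamma> t i #> g)"
      by (auto simp: faces_of_rank_eq)
    then have F: "\<rho> F = image_under (B i) (\<phi> g)"
      using i by (simp add: \<rho>_coset)
    show "\<rho> F \<noteq> {}"
      using assms(1)[OF i] by (simp add: F image_under_def)
    show "open_set_of_dim (nat i) (\<rho> F)"
      unfolding F by (rule open_set_of_dim_image_under[OF g(1) assms(2)[OF i]])
    let ?E = "(i, face_group \<Gamma> t i)"
    have Gi: "face_group \<Gamma> t i #> \<one> = face_group \<Gamma> t i"
      using subgroup.subset[OF subgroup_face_group[OF gens]] by (rule coset_mult_one)
    then have E: "?E \<in> faces_of_rank \<Gamma> t i"
      using i by (subst faces_of_rank_eq) (auto intro!: image_eqI[of _ _ \<one>])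
    have F_act: "F = face_act \<Gamma> ?E g"
      using g(2) by (simp add: face_act_def)
    have "boundary (\<rho> F) = (\<Union>k\<in>{0..<i}. \<Union>H\<in>{H \<in> faces_of_rank \<Gamma> t k. face_le H ?E}. image_under (\<rho> H) (\<phi> g))"
      unfolding F boundary_image_under[OF g(1)] base_boundary[OF i]
      by (auto simp: image_under_def)
    also have "\<dots> = (\<Union>k\<in>{0..<i}. \<Union>H\<in>{H \<in> faces_of_rank \<Gamma> t k. face_le H F}. \<rho> H)"
    proof (rule SUP_cong[OF refl])
      fix k assume "k \<in> {0..<i}"
      then have k: "k \<in> {-1..3}" "i \<in> {-1..3}"
        using i by auto
      show "(\<Union>H\<in>{H \<in> faces_of_rank \<Gamma> t k. face_le H ?E}. image_under (\<rho> H) (\<phi> g)) =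
            (\<Union>H\<in>{H \<in> faces_of_rank \<Gamma> t k. face_le H F}. \<rho> H)"
        unfolding F_act lower_faces_face_act[OF gens g(1) k E]
        using \<rho>_face_act[OF _ k(1) g(1)] by auto
    qed
    finally show "boundary (\<rho> F) = (\<Union>k\<in>{0..<i}. \<Union>H\<in>{H \<in> faces_of_rank \<Gamma> t k. face_le H F}. \<rho> H)" .
  qed (rule \<rho>_empty_face)
  moreover have "\<rho> (face_act \<Gamma> F g) = image_under (\<rho> F) (\<phi> g)"
    if "g \<in> carrier \<Gamma>" "F \<in> faces \<Gamma> t" for g F
    using that by (intro \<rho>_face_act[of F "fst F"]) (auto simp: faces_of_rank_def faces_def)
  ultimately show ?thesis
    using rep unfolding symmetric_realization_def by blast
qed

text \<open>
  If the images of \<open>B i\<close> under \<open>\<phi> g\<close> and \<open>\<phi> h\<close> agree, then \<open>g \<otimes> inv h\<close> stabilizes \<open>B i\<close>, so \<open>g\<close>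
  and \<open>h\<close> lie in the same coset. The empty face is the only face of rank \<open>-1\<close>, as its group is
  the whole of \<open>\<Gamma>\<close>.
\<close>

lemma inj_on_faces_of_rank:
  assumes "i \<in> {-1..3}"
    and "\<And>g. i \<noteq> -1 \<Longrightarrow> g \<in> carrier \<Gamma> \<Longrightarrow> image_under (B i) (\<phi> g) = B i \<Longrightarrow> g \<in> face_group \<Gamma> t i"
  shows "inj_on \<rho> (faces_of_rank \<Gamma> t i)"
proof (rule inj_onI)
  fix F H
  assume FH: "F \<in> faces_of_rank \<Gamma> t i" "H \<in> faces_of_rank \<Gamma> t i" "\<rho> F = \<rho> H"
  then obtain g h where g: "g \<in> carrier \<Gamma>" "F = (i, face_group \<Gamma> t i #> g)"
    and h: "h \<in> carrier \<Gamma>" "H = (i, face_group \<Gamma> t i #> h)"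
    using assms(1) by (auto simp: faces_of_rank_eq)
  have "g \<otimes> inv h \<in> face_group \<Gamma> t i"
  proof (cases "i = -1")
    case True
    then show ?thesis
      using g h by (simp add: face_group_def)
  next
    case False
    then have i: "i \<in> {0..3}"
      using assms(1) by auto
    have "image_under (B i) (\<phi> (g \<otimes> inv h)) = image_under (image_under (B i) (\<phi> h)) (\<phi> (inv h))"
      using FH(3) g h i by (simp add: \<rho>_coset image_under_mult)
    also have "\<dots> = B i"
      using h by (simp flip: image_under_mult)
    finally show ?thesis
      using assms(2)[OF False, of "g \<otimes> inv h"] g h by simp
  qed
  then have "face_group \<Gamma> t i #> (g \<otimes> inv h) = face_group \<Gamma> t i"
    using g h subgroup_face_group[OF gens] by (intro coset_join2) auto
  then have "face_group \<Gamma> t i #> g = face_group \<Gamma> t i #> h"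
    using g h subgroup.subset[OF subgroup_face_group[OF gens]] by (intro coset_mult_inv1) auto
  then show "F = H"
    using g h by simp
qed

end

section \<open>Realizations by Wythoff's construction\<close>

theorem theorem3p1:
  fixes \<Gamma> :: "('g, 'm) monoid_scheme"
    and t :: "int \<Rightarrow> 'g"
    and p q :: nat
    and \<phi> :: "'g \<Rightarrow> real^3^3"
    and \<gamma> :: "int \<Rightarrow> nat \<Rightarrow> 'g"
    and x :: "real^3"
    and \<O> :: "int \<Rightarrow> nat \<Rightarrow> (real^3) set"
    and \<rho> :: "'g face \<Rightarrow> (real^3) set"
  assumes "string_C_group \<Gamma> t p q"
    and "orthogonal_rep \<Gamma> \<phi>" and "faithful_rep \<Gamma> \<phi>" and "irreducible_rep \<Gamma> \<phi>"
    and "\<And>i. i \<in> {0..3} \<Longrightarrow> coset_representatives \<Gamma> t i (\<gamma> i)"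
    and "x \<in> wythoff_space \<phi> t"
    and "\<O> 0 1 = {x}"
    and "\<And>i j. i \<in> {0..3} \<Longrightarrow> j \<in> {1..index \<Gamma> t i} \<Longrightarrow>
           \<O> i j = image_under (\<O> i 1) (\<phi> (\<gamma> i j))"
    and "\<And>i. i \<in> {1..3} \<Longrightarrow> \<O> i 1 \<noteq> {}"
    and "\<And>i. i \<in> {1..3} \<Longrightarrow> open_set_of_dim (nat i) (\<O> i 1)"
    and "\<And>i. i \<in> {1..3} \<Longrightarrow>
           boundary (\<O> i 1) =
             (\<Union>k\<in>{0..<i}. \<Union>l\<in>{l \<in> {1..index \<Gamma> t k}. face_le (face \<Gamma> t \<gamma> k l) (face \<Gamma> t \<gamma> i 1)}.
                \<O> k l)"
    and "\<And>i. i \<in> {1..3} \<Longrightarrow>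
           set_stabilizer (\<phi> ` carrier \<Gamma>) (\<O> i 1) = \<phi> ` face_group \<Gamma> t i"
    and "\<And>F. F \<in> faces_of_rank \<Gamma> t (-1) \<Longrightarrow> \<rho> F = {}"
    and "\<And>i j. i \<in> {0..3} \<Longrightarrow> j \<in> {1..index \<Gamma> t i} \<Longrightarrow> \<rho> (face \<Gamma> t \<gamma> i j) = \<O> i j"
  shows "symmetric_realization \<Gamma> t \<rho> \<and> (x \<noteq> 0 \<longrightarrow> faithful_realization \<Gamma> t \<rho>)"
proof -
  interpret orthogonal_action \<Gamma> \<phi>
    using assms(1,2)
    by (auto simp: string_C_group_def orthogonal_action_def orthogonal_action_axioms_def)
  have gens: "t ` {0..2} \<subseteq> carrier \<Gamma>"
    using assms(1) by (simp add: string_C_group_def)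
  note face_subgroup = subgroup_face_group[OF gens]
  have vertex_group: "face_group \<Gamma> t 0 \<subseteq> stabilizer x"
    unfolding vertex_group_eq
    by (intro generate_subgroup_incl subgroup_stabilizer
        wythoff_generators_subset_stabilizer[OF gens assms(6)])
  have rank_cases: "i = 0 \<or> i \<in> {1..3}" if "i \<in> {0..3}" for i :: int
    using that by auto
  have invariant: "image_under (\<O> i 1) (\<phi> g) = \<O> i 1"
    if "i \<in> {0..3}" "g \<in> face_group \<Gamma> t i" for i g
    using rank_cases[OF that(1)]
  proof
    assume "i = 0"
    then show ?thesis
      using that vertex_group assms(7) by (auto simp: image_under_def stabilizer_def)
  next
    assume "i \<in> {1..3}"
    then have "\<phi> g \<in> set_stabilizer (\<phi> ` carrier \<Gamma>) (\<O> i 1)"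
      using assms(12) that(2) by blast
    then show ?thesis
      by (simp add: set_stabilizer_def)
  qed
  have rcosets_eq: "rcosets\<^bsub>\<Gamma>\<^esub> (face_group \<Gamma> t i) =
      (\<lambda>j. face_group \<Gamma> t i #>\<^bsub>\<Gamma>\<^esub> \<gamma> i j) ` {1..index \<Gamma> t i}" if "i \<in> {0..3}" for i
    using assms(5)[OF that] by (simp add: coset_representatives_def bij_betw_def)
  \<comment> \<open>Any \<open>g\<close> is \<open>h \<otimes> \<gamma> i j\<close> for a listed representative and some \<open>h\<close> in the base subgroup,
  and \<open>h\<close> leaves the base set invariant.\<close>
  have coset: "\<rho> (i, face_group \<Gamma> t i #>\<^bsub>\<Gamma>\<^esub> g) = image_under (\<O> i 1) (\<phi> g)"
    if i: "i \<in> {0..3}" and g: "g \<in> carrier \<Gamma>" for i g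
  proof -
    have "face_group \<Gamma> t i #>\<^bsub>\<Gamma>\<^esub> g \<in> rcosets\<^bsub>\<Gamma>\<^esub> (face_group \<Gamma> t i)"
      using g subgroup.subset[OF face_subgroup] by (rule rcosetsI[rotated])
    then obtain j where j: "j \<in> {1..index \<Gamma> t i}" "face_group \<Gamma> t i #>\<^bsub>\<Gamma>\<^esub> g = face_group \<Gamma> t i #>\<^bsub>\<Gamma>\<^esub> \<gamma> i j"
      unfolding rcosets_eq[OF i] by auto
    have \<gamma>: "\<gamma> i j \<in> carrier \<Gamma>"
      using assms(5)[OF i] j(1) by (auto simp: coset_representatives_def)
    obtain h where h: "h \<in> face_group \<Gamma> t i" "g = h \<otimes>\<^bsub>\<Gamma>\<^esub> \<gamma> i j"
      using rcos_self[OF g face_subgroup, of i] j(2) by (auto simp: r_coset_def)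
    have "\<rho> (i, face_group \<Gamma> t i #>\<^bsub>\<Gamma>\<^esub> g) = image_under (\<O> i 1) (\<phi> (\<gamma> i j))"
      using assms(14)[OF i j(1)] assms(8)[OF i j(1)] by (simp add: face_def j(2))
    also have "\<dots> = image_under (\<O> i 1) (\<phi> g)"
      using h \<gamma> subgroup.mem_carrier[OF face_subgroup h(1)] invariant[OF i h(1)]
      by (simp add: image_under_mult)
    finally show ?thesis .
  qed
  interpret wythoff_construction \<Gamma> \<phi> t "\<lambda>i. \<O> i 1" \<rho>
    using gens invariant coset assms(13) by unfold_locales auto
  have faces_enum: "faces_of_rank \<Gamma> t k = face \<Gamma> t \<gamma> k ` {1..index \<Gamma> t k}" if "k \<in> {0..3}" for k
    using that by (auto simp: faces_of_rank_def faces_def face_def rcosets_eq[OF that])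
  have base_face: "face \<Gamma> t \<gamma> i 1 = (i, face_group \<Gamma> t i)" if "i \<in> {0..3}" for i
    using assms(5)[OF that] subgroup.subset[OF face_subgroup]
    by (simp add: face_def coset_representatives_def)
  have boundary: "boundary (\<O> i 1) =
          (\<Union>k\<in>{0..<i}. \<Union>H\<in>{H \<in> faces_of_rank \<Gamma> t k. face_le H (i, face_group \<Gamma> t i)}. \<rho> H)"
    if i: "i \<in> {0..3}" for i
    using rank_cases[OF i]
  proof
    assume "i = 0"
    then show ?thesis
      using assms(7) by (simp add: boundary_def)
  next
    assume i': "i \<in> {1..3}"
    have "(\<Union>l\<in>{l \<in> {1..index \<Gamma> t k}. face_le (face \<Gamma> t \<gamma> k l) (face \<Gamma> t \<gamma> i 1)}. \<O> k l) =
          (\<Union>H\<in>{H \<in> faces_of_rank \<Gamma> t k. face_le H (i, face_group \<Gamma> t i)}. \<rho> H)"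
      if "k \<in> {0..<i}" for k
    proof -
      have k: "k \<in> {0..3}"
        using that i by auto
      show ?thesis
        unfolding faces_enum[OF k] base_face[OF i] using assms(14)[OF k] by fastforce
    qed
    then show ?thesis
      unfolding assms(11)[OF i'] by (intro SUP_cong refl)
  qed
  have symmetric: "symmetric_realization \<Gamma> t \<rho>"
  proof (rule symmetric_realization_transport[OF _ _ boundary])
    fix i :: int
    assume i: "i \<in> {0..3}"
    show "\<O> i 1 \<noteq> {}"
      using rank_cases[OF i] assms(7,9) by auto
    show "open_set_of_dim (nat i) (\<O> i 1)"
      using rank_cases[OF i] assms(7,10) open_set_of_dim_point[of x] by auto
  qed
  moreover have "faithful_realization \<Gamma> t \<rho>" if "x \<noteq> 0"
  proof -
    have "g \<in> face_group \<Gamma> t i"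
      if i: "i \<in> {0..3}" and g: "g \<in> carrier \<Gamma>" and fixed: "image_under (\<O> i 1) (\<phi> g) = \<O> i 1" for i g
      using rank_cases[OF i]
    proof
      assume "i = 0"
      then have "g \<in> stabilizer x"
        using g fixed assms(7) by (simp add: image_under_def stabilizer_def)
      then show ?thesis
        using \<open>i = 0\<close> stabilizer_wythoff_point[OF assms(1,3,4,6) \<open>x \<noteq> 0\<close>] by simp
    next
      assume "i \<in> {1..3}"
      have "\<phi> g \<in> set_stabilizer (\<phi> ` carrier \<Gamma>) (\<O> i 1)"
        using g fixed by (simp add: set_stabilizer_def)
      then have "\<phi> g \<in> \<phi> ` face_group \<Gamma> t i"
        unfolding assms(12)[OF \<open>i \<in> {1..3}\<close>] .
      then show ?thesis
        using g assms(3) subgroup.mem_carrier[OF face_subgroup]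
        by (auto simp: faithful_rep_def dest: inj_onD)
    qed
    then have "inj_on \<rho> (faces_of_rank \<Gamma> t i)" if "i \<in> {-1..3}" for i
      using that by (intro inj_on_faces_of_rank) auto
    then show ?thesis
      using symmetric by (simp add: faithful_realization_def symmetric_realization_def)
  qed
  ultimately show ?thesis
    by blast
qed

end
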